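(* Let $M$ be an ordered $\Gamma$-groupoid and let $\mu : M \to [0,1]$ be a fuzzy subset of $M$. (i) If $\mu$ is a fuzzy left ideal of $M$ and $t\in[0,1]$ is such that $\mu_t \neq \emptyset$, then $\mu_t$ is a left ideal of $M$. (ii) Conversely, if $\mu_t$ is a left ideal of $M$ for every $t\in[0,1]$, then $\mu$ is a fuzzy left ideal of $M$.
   Context: Let $M,\Gamma$ be nonempty sets. $M$ is a $\Gamma$-groupoid if there is a well-defined operation $M\times\Gamma\times M\to M$, $(a,\gamma,b)\mapsto a\gamma b$ (no associativity assumed). An ordered $\Gamma$-groupoid is a $\Gamma$-groupoid $M$ with a partial order $\le$ on $M$ such that $a\le b$ implies $a\gamma c\le b\gamma c$ and $c\gamma a\le c\gamma b$ for all $c\in M$, $\gamma\in\Gamma$. A nonempty subset $A\subseteq M$ is a left ideal of $M$ if (1) $x\gamma a\in A$ for all $x\in M,\gamma\in\Gamma,a\in A$, and (2) $a\in A$, $b\in M$, $b\le a$ imply $b\in A$. (In particular left ideals are nonempty by definition.) A fuzzy subset of $M$ is any mapping $\mu:M\to[0,1]$. It is a fuzzy left ideal of $M$ if (1) $\mu(x\gamma y)\ge\mu(y)$ for all $x,y\in M$, $\gamma\in\Gamma$, and (2) $x\le y$ implies $\mu(x)\ge\mu(y)$. For $t\in[0,1]$, the level subset is $\mu_t:=\{x\in M\mid \mu(x)\ge t\}$. *)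

theory Defs
  imports Complex_Main "HOL-Library.FuncSet"
begin

locale gamma_groupoid =
  fixes M :: "'m set" and \<Gamma> :: "'g set"
    and opr :: "'m \<Rightarrow> 'g \<Rightarrow> 'm \<Rightarrow> 'm"
  assumes carrier_nonempty: "M \<noteq> {}"
    and index_nonempty: "\<Gamma> \<noteq> {}"
    and opr_closed: "opr \<in> M \<rightarrow> \<Gamma> \<rightarrow> M \<rightarrow> M"

text \<open>The order is a relation \<open>le\<close>, where \<open>(a, b) \<in> le\<close> stands for \<open>a \<le> b\<close>;
  \<^const>\<open>partial_order_on\<close> includes \<open>le \<subseteq> M \<times> M\<close>.\<close>

locale ordered_gamma_groupoid = gamma_groupoid M \<Gamma> opr
  for M :: "'m set" and \<Gamma> :: "'g set"
    and opr :: "'m \<Rightarrow> 'g \<Rightarrow> 'm \<Rightarrow> 'm" +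
  fixes le :: "'m rel"
  assumes partial_order: "partial_order_on M le"
    and opr_mono_left:
      "\<lbrakk>(a, b) \<in> le; c \<in> M; \<gamma> \<in> \<Gamma>\<rbrakk> \<Longrightarrow> (opr a \<gamma> c, opr b \<gamma> c) \<in> le"
    and opr_mono_right:
      "\<lbrakk>(a, b) \<in> le; c \<in> M; \<gamma> \<in> \<Gamma>\<rbrakk> \<Longrightarrow> (opr c \<gamma> a, opr c \<gamma> b) \<in> le"

definition left_ideal ::
    "'m set \<Rightarrow> 'g set \<Rightarrow> ('m \<Rightarrow> 'g \<Rightarrow> 'm \<Rightarrow> 'm) \<Rightarrow> 'm rel \<Rightarrow> 'm set \<Rightarrow> bool" where
  "left_ideal M \<Gamma> opr le A \<longleftrightarrow>
     A \<noteq> {} \<and> A \<subseteq> M \<and>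
     (\<forall>x\<in>M. \<forall>\<gamma>\<in>\<Gamma>. \<forall>a\<in>A. opr x \<gamma> a \<in> A) \<and>
     (\<forall>a\<in>A. \<forall>b\<in>M. (b, a) \<in> le \<longrightarrow> b \<in> A)"

text \<open>Only the values on \<open>M\<close> matter; \<open>\<mu>\<close> is unconstrained outside \<open>M\<close>.\<close>

definition fuzzy_subset :: "'m set \<Rightarrow> ('m \<Rightarrow> real) \<Rightarrow> bool" where
  "fuzzy_subset M \<mu> \<longleftrightarrow> \<mu> \<in> M \<rightarrow> {0..1}"

definition fuzzy_left_ideal ::
    "'m set \<Rightarrow> 'g set \<Rightarrow> ('m \<Rightarrow> 'g \<Rightarrow> 'm \<Rightarrow> 'm) \<Rightarrow> 'm rel \<Rightarrow> ('m \<Rightarrow> real) \<Rightarrow> bool" where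
  "fuzzy_left_ideal M \<Gamma> opr le \<mu> \<longleftrightarrow>
     fuzzy_subset M \<mu> \<and>
     (\<forall>x\<in>M. \<forall>y\<in>M. \<forall>\<gamma>\<in>\<Gamma>. \<mu> (opr x \<gamma> y) \<ge> \<mu> y) \<and>
     (\<forall>x\<in>M. \<forall>y\<in>M. (x, y) \<in> le \<longrightarrow> \<mu> x \<ge> \<mu> y)"

definition level_subset :: "'m set \<Rightarrow> ('m \<Rightarrow> real) \<Rightarrow> real \<Rightarrow> 'm set" where
  "level_subset M \<mu> t = {x \<in> M. \<mu> x \<ge> t}"

end

theory Submission
  imports Defs
begin

text \<open>Both fuzzy conditions have the form \<open>\<mu> q \<le> \<mu> p\<close>, with p either
  a product x\<gamma>q or an element below q. For p, q in \<open>M\<close>, such an inequality says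
  exactly that every level subset containing q also contains p: transitivity gives one direction,
  and the level t = \<mu>(q) gives the other. Absorption and downward closure of the level subsets
  are thus the two fuzzy conditions read level by level.\<close>

theorem theorem4:
  fixes M :: "'m set" and \<Gamma> :: "'g set"
    and opr :: "'m \<Rightarrow> 'g \<Rightarrow> 'm \<Rightarrow> 'm" and le :: "'m rel"
    and \<mu> :: "'m \<Rightarrow> real"
  assumes "ordered_gamma_groupoid M \<Gamma> opr le"
    and "fuzzy_subset M \<mu>"
  shows "(fuzzy_left_ideal M \<Gamma> opr le \<mu> \<longrightarrow>
            (\<forall>t\<in>{0..1}. level_subset M \<mu> t \<noteq> {} \<longrightarrow>
               left_ideal M \<Gamma> opr le (level_subset M \<mu> t)))
       \<and> ((\<forall>t\<in>{0..1}. left_ideal M \<Gamma> opr le (level_subset M \<mu> t)) \<longrightarrow>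
            fuzzy_left_ideal M \<Gamma> opr le \<mu>)"
proof (intro conjI impI ballI)
  interpret ordered_gamma_groupoid M \<Gamma> opr le by fact
  have closed: "opr x \<gamma> y \<in> M" if "x \<in> M" "\<gamma> \<in> \<Gamma>" "y \<in> M" for x \<gamma> y
    using opr_closed that by blast
  show "left_ideal M \<Gamma> opr le (level_subset M \<mu> t)"
    if "fuzzy_left_ideal M \<Gamma> opr le \<mu>" and "level_subset M \<mu> t \<noteq> {}" for t
    \<comment> \<open>For a in the level subset, t \<le> \<mu>(a) \<le> \<mu>(p) by
      \<open>order_trans\<close> on the reals; \<open>closed\<close> puts the products p =
      x\<gamma>a back into \<open>M\<close>.\<close>
    using that closed
    unfolding left_ideal_def fuzzy_left_ideal_def level_subset_def
    by (auto intro: order_trans)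
  show "fuzzy_left_ideal M \<Gamma> opr le \<mu>"
    if ideal: "\<forall>t\<in>{0..1}. left_ideal M \<Gamma> opr le (level_subset M \<mu> t)"
  proof -
    \<comment> \<open>Both inequalities at \<open>y\<close> are read off the level \<open>t = \<mu> y\<close>.\<close>
    have level: "left_ideal M \<Gamma> opr le (level_subset M \<mu> (\<mu> y))"
      and mem: "y \<in> level_subset M \<mu> (\<mu> y)" if "y \<in> M" for y
      \<comment> \<open>The values of \<mu> on \<open>M\<close> lie in [0,1], so \<mu>(y) is an
        admissible level.\<close>
      using ideal \<open>fuzzy_subset M \<mu>\<close> that
      by (auto simp: fuzzy_subset_def level_subset_def)
    have "\<mu> y \<le> \<mu> (opr x \<gamma> y)" if "x \<in> M" "y \<in> M" "\<gamma> \<in> \<Gamma>" for x y \<gamma>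
    proof -
      have "opr x \<gamma> y \<in> level_subset M \<mu> (\<mu> y)"
        using level mem that unfolding left_ideal_def by blast
      then show ?thesis by (simp add: level_subset_def)
    qed
    moreover have "\<mu> y \<le> \<mu> x" if "x \<in> M" "y \<in> M" "(x, y) \<in> le" for x y
    proof -
      have "x \<in> level_subset M \<mu> (\<mu> y)"
        using level mem that unfolding left_ideal_def by blast
      then show ?thesis by (simp add: level_subset_def)
    qed
    ultimately show ?thesis
      using \<open>fuzzy_subset M \<mu>\<close> by (simp add: fuzzy_left_ideal_def)
  qed
qed

end
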